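(* Let $S$ be a regular semigroup containing $X$ as a subset such that $S$ is weakly generated by $X$. Then there is a surjective semigroup homomorphism $\varphi: F_X\to S$ with $[x]\varphi=x$ for all $x\in X$. In particular every regular semigroup weakly generated by $X$ is a homomorphic image of $F_X$ under a homomorphism whose restriction to $X$ (identified with $\{[x]:x\in X\}\subseteq F_X$) is the identity.
   Context: Let $X$ be a nonempty set and $X'=\{x':x\in X\}$ a disjoint copy of $X$; let $1$ be a new symbol and $A=X\cup X'\cup\{1\}$ (the anchors), with the involution $1'=1$, $(x)'=x'$, $(x')'=x$ for $x\in X$. For a 5-tuple $g$ write $g=(g^l,g^{la},g^c,g^{ra},g^r)$ (left entry, left anchor, middle entry, right anchor, right entry); the notation iterates, e.g. for $s\in\{l,r\}$, $g^{ls}$ is the $s$-entry of $g^l$ and $g^{lsa}$ is the $s$-anchor of $g^l$. Define $\mathcal G_0=\{1\}$; $\mathcal G_{1,e}=\{g_{xx'}:x\in X\}$ where $g_{xx'}=(1,1,xx',x',1)$ (the middle entry is a formal symbol), and $\mathcal G_{1,d}=\emptyset$. For $i\ge 2$: $\mathcal G_{i,e}=\{(g,(g^{la})',g^l,(g^{ra})',g),\ (g,(g^{ra})',g^l,(g^{la})',g) : g\in\mathcal G_{i-1,e}\}$, and $\mathcal G_{i,d}$ is the set of all $g\in\mathcal G_{i-1}\times A\times\mathcal G_{i-2}\times A\times\mathcal G_{i-1}$ such that $g^l\neq g^r$, $(g^c,g^{la})=(g^{ls},(g^{lsa})')$ for some $s\in\{l,r\}$, and $(g^c,g^{ra})=(g^{rt},(g^{rta})')$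 for some $t\in\{l,r\}$; here $\mathcal G_i=\mathcal G_{i,d}\cup\mathcal G_{i,e}$ for $i\ge1$. Put $\mathcal G^5=\bigcup_{i\ge1}\mathcal G_i$, $\mathcal G=\mathcal G^5\cup A$, $\mathcal G'=\mathcal G^5\cup\{1\}$ (the symbol $1$ is used both as an anchor and as a letter of $\mathcal G'$). The height of $g\in\mathcal G_i$ is $i$; $1$ has height $0$. For $g\in\mathcal G^5$ of height $\ge2$ let $g^L=(g^{la})'g^lg^{la}$ and $g^R=(g^{ra})'g^rg^{ra}$, words of the free semigroup $\mathcal G^+$ on the alphabet $\mathcal G$. Let $\rho$ be the congruence on $\mathcal G^+$ generated by the pairs $(xx'x,x)$, $(x'xx',x')$, $(g_{xx'},xx')$ for $x\in X$; $(1g,g)$, $(g1,g)$, $(gg,g)$ for $g\in\mathcal G'$; and $(g^cg^Lg,g)$, $(gg^Rg^c,g)$, $(g^Rgg^L,g^Rg^cg^L)$ for $g\in\mathcal G^5$ of height $\ge2$. Write $[u]$ for the $\rho$-class of $u\in\mathcal G^+$. Let $F^1_X=\mathcal G^+/\rho$ (a monoid with identity $[1]$) and let $F_X$ be the subsemigroup of $F^1_X$ generated by $\{[g]: g\in\mathcal G\setminus\{1\}\}$. A regular semigroup $S$ is weakly generated by a subset $Y\subseteq S$ if no proper regular subsemigroup of $S$ contains $Y$. *)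

theory Defs
  imports Main
begin

text \<open>Symbols: the anchor/letter 1 (One), x (Pos x), x' (Neg x), the formal middle
  symbol xx' (XX x), and 5-tuples Tup l la c ra r.\<close>
datatype 'x sym = One | Pos 'x | Neg 'x | XX 'x
  | Tup (eL: "'x sym") (aL: "'x sym") (eC: "'x sym") (aR: "'x sym") (eR: "'x sym")

definition Anc :: "'x set \<Rightarrow> 'x sym set" where
  "Anc X = {One} \<union> Pos ` X \<union> Neg ` X"

fun ainv :: "'x sym \<Rightarrow> 'x sym" where
  "ainv One = One"
| "ainv (Pos x) = Neg x"
| "ainv (Neg x) = Pos x"
| "ainv s = s"

definition selE :: "bool \<Rightarrow> 'x sym \<Rightarrow> 'x sym" where
  "selE s h = (if s then eL h else eR h)"
definition selA :: "bool \<Rightarrow> 'x sym \<Rightarrow> 'x sym" where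
  "selA s h = (if s then aL h else aR h)"

definition gxx :: "'x \<Rightarrow> 'x sym" where
  "gxx x = Tup One One (XX x) (Neg x) One"

fun GE :: "'x set \<Rightarrow> nat \<Rightarrow> 'x sym set" where
  "GE X 0 = {}"
| "GE X (Suc 0) = gxx ` X"
| "GE X (Suc (Suc n)) =
     {Tup g (ainv (aL g)) (eL g) (ainv (aR g)) g | g. g \<in> GE X (Suc n)}
   \<union> {Tup g (ainv (aR g)) (eL g) (ainv (aL g)) g | g. g \<in> GE X (Suc n)}"

fun Glev :: "'x set \<Rightarrow> nat \<Rightarrow> 'x sym set" where
  "Glev X 0 = {One}"
| "Glev X (Suc 0) = GE X (Suc 0)"
| "Glev X (Suc (Suc n)) = GE X (Suc (Suc n)) \<union>
     {Tup l a c b r | l a c b r.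
        l \<in> Glev X (Suc n) \<and> a \<in> Anc X \<and> c \<in> Glev X n \<and> b \<in> Anc X \<and> r \<in> Glev X (Suc n)
        \<and> l \<noteq> r
        \<and> (\<exists>s. c = selE s l \<and> a = ainv (selA s l))
        \<and> (\<exists>t. c = selE t r \<and> b = ainv (selA t r))}"

definition GD :: "'x set \<Rightarrow> nat \<Rightarrow> 'x sym set" where
  "GD X i = Glev X i - GE X i"

definition G5 :: "'x set \<Rightarrow> 'x sym set" where
  "G5 X = (\<Union>i\<in>{1..}. Glev X i)"

definition G5h2 :: "'x set \<Rightarrow> 'x sym set" where
  "G5h2 X = (\<Union>i\<in>{2..}. Glev X i)"

definition Gen :: "'x set \<Rightarrow> 'x sym set" where
  "Gen X = G5 X \<union> Anc X"

definition Gp :: "'x set \<Rightarrow> 'x sym set" where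
  "Gp X = G5 X \<union> {One}"

definition wL :: "'x sym \<Rightarrow> 'x sym list" where
  "wL g = [ainv (aL g), eL g, aL g]"
definition wR :: "'x sym \<Rightarrow> 'x sym list" where
  "wR g = [ainv (aR g), eR g, aR g]"

definition Rgen :: "'x set \<Rightarrow> ('x sym list \<times> 'x sym list) set" where
  "Rgen X =
     {([Pos x, Neg x, Pos x], [Pos x]) | x. x \<in> X}
   \<union> {([Neg x, Pos x, Neg x], [Neg x]) | x. x \<in> X}
   \<union> {([gxx x], [Pos x, Neg x]) | x. x \<in> X}
   \<union> {([One, g], [g]) | g. g \<in> Gp X}
   \<union> {([g, One], [g]) | g. g \<in> Gp X}
   \<union> {([g, g], [g]) | g. g \<in> Gp X}
   \<union> {([eC g] @ wL g @ [g], [g]) | g. g \<in> G5h2 X}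
   \<union> {([g] @ wR g @ [eC g], [g]) | g. g \<in> G5h2 X}
   \<union> {(wR g @ [g] @ wL g, wR g @ [eC g] @ wL g) | g. g \<in> G5h2 X}"

definition Words :: "'x set \<Rightarrow> 'x sym list set" where
  "Words X = {w. w \<in> lists (Gen X) \<and> w \<noteq> []}"

inductive rho :: "'x set \<Rightarrow> 'x sym list \<Rightarrow> 'x sym list \<Rightarrow> bool" for X where
  gen: "(u, v) \<in> Rgen X \<Longrightarrow> rho X u v"
| refl: "u \<in> Words X \<Longrightarrow> rho X u u"
| sym: "rho X u v \<Longrightarrow> rho X v u"
| trans: "rho X u v \<Longrightarrow> rho X v w \<Longrightarrow> rho X u w"
| ctx: "rho X u v \<Longrightarrow> p \<in> lists (Gen X) \<Longrightarrow> q \<in> lists (Gen X) \<Longrightarrow> rho X (p @ u @ q) (p @ v @ q)"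

definition cls :: "'x set \<Rightarrow> 'x sym list \<Rightarrow> 'x sym list set" where
  "cls X u = {v. rho X u v}"

text \<open>Words over the generators G \ {1}; their classes form the subsemigroup F_X of F^1_X.\<close>
definition FXwords :: "'x set \<Rightarrow> 'x sym list set" where
  "FXwords X = {w. w \<in> lists (Gen X - {One}) \<and> w \<noteq> []}"

definition FX :: "'x set \<Rightarrow> 'x sym list set set" where
  "FX X = cls X ` FXwords X"

definition regular_sg :: "'a::semigroup_mult set \<Rightarrow> bool" where
  "regular_sg T \<longleftrightarrow> (\<forall>a\<in>T. \<forall>b\<in>T. a * b \<in> T) \<and> (\<forall>a\<in>T. \<exists>b\<in>T. a * b * a = a)"

definition weakly_generated :: "'a::semigroup_mult set \<Rightarrow> bool" where
  "weakly_generated Y \<longleftrightarrow> (\<forall>T. regular_sg T \<and> Y \<subseteq> T \<longrightarrow> T = UNIV)"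

end

theory Submission
  imports Defs
begin

text \<open>
  Map \<open>x'\<close> to an inverse of \<open>x\<close> and, recursively, each tuple \<open>g\<close> of height at least 2 to an element of
  the sandwich set of the idempotents \<open>g\<^sup>R g\<^sup>c\<close> and \<open>g\<^sup>c g\<^sup>L\<close>, computed in \<open>S\<close> with a new identity
  adjoined. The defining relations of \<open>\<rho>\<close> hold for these values, whence a homomorphism.
  For surjectivity, view words as paths that climb and descend between a tuple and its side entries.
  The relations allow a valley \<open>r\<close>, \<open>c\<close>, \<open>l\<close> of such a path either to be cancelled or to be
  replaced by the hill \<open>r\<close>, \<open>g\<close>, \<open>l\<close> with \<open>g = (l, _, c, _, r)\<close>, so paths that descend and then
  climb can be rewritten to climb and then descend. Consequently the values of mountains
  (paths from 1 up to a peak and back down to 1) are closed under products. Reversing a mountain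
  gives an inverse, so these values form a regular subsemigroup containing \<open>X\<close>, which must be \<open>S\<close>.
\<close>

section \<open>Adjoining an identity to a semigroup\<close>

text \<open>The identity is new even if the semigroup already has one. Thus \<open>Unit\<close>
  arises only as a product of \<open>Unit\<close>s, which keeps values of nonempty words without
  \<open>One\<close> inside the original semigroup.\<close>

datatype 'a with_one = Unit | Elem (un_elem: 'a)

instantiation with_one :: (semigroup_mult) monoid_mult
begin

definition one_with_one :: "'a with_one" where
  "one_with_one = Unit"

fun times_with_one :: "'a with_one \<Rightarrow> 'a with_one \<Rightarrow> 'a with_one" where
  "times_with_one Unit y = y"
| "times_with_one x Unit = x"
| "times_with_one (Elem a) (Elem b) = Elem (a * b)"

instance
proof
  fix a b c :: "'a with_one"
  show "a * b * c = a * (b * c)"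
    by (cases a; cases b; cases c) (simp_all add: mult.assoc)
  show "1 * a = a" by (simp add: one_with_one_def)
  show "a * 1 = a" by (cases a) (simp_all add: one_with_one_def)
qed

end

lemma with_one_mult_eq_Unit_iff: "a * b = Unit \<longleftrightarrow> a = Unit \<and> b = Unit"
  by (cases a; cases b) auto

lemma with_one_regular:
  fixes s :: "'a::semigroup_mult with_one"
  assumes "regular_sg (UNIV :: 'a set)"
  shows "\<exists>t. s * t * s = s"
proof (cases s)
  case Unit
  then show ?thesis by (metis times_with_one.simps(1))
next
  case (Elem a)
  obtain b where "a * b * a = a" using assms unfolding regular_sg_def by blast
  then have "s * Elem b * s = s" using Elem by simp
  then show ?thesis ..
qed

text \<open>Turns an equation into a rewrite rule that applies inside right-nested products.\<close>

lemma mult_ext: "a = b \<Longrightarrow> a * z = b * (z::'m::semigroup_mult)"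
  by simp

section \<open>Anchors, side entries and heights\<close>

lemma ainv_ainv: "a \<in> Anc X \<Longrightarrow> ainv (ainv a) = a"
  by (auto simp: Anc_def)

lemma ainv_Anc: "a \<in> Anc X \<Longrightarrow> ainv a \<in> Anc X"
  by (auto simp: Anc_def)

lemma GE_subset_Glev: "GE X n \<subseteq> Glev X n"
  by (cases "(X, n)" rule: Glev.cases) auto

lemma GE_sides:
  "g \<in> GE X n \<Longrightarrow> eR g = eL g \<and> eL g \<in> Glev X (n - 1) \<and> aL g \<in> Anc X \<and> aR g \<in> Anc X"
proof (induction X n arbitrary: g rule: GE.induct)
  case (2 X)
  then show ?case by (auto simp: gxx_def Anc_def)
next
  case (3 X n)
  then show ?case using GE_subset_Glev[of X "Suc n"] by (auto simp: ainv_Anc)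
qed simp

text \<open>A tuple built from a single \<open>h\<close> in \<open>GE\<close> fits the general
  pattern with \<open>l = r = h\<close> and opposite \<open>s\<close> and \<open>t\<close>, because
  both side entries of \<open>h\<close> agree. Later arguments can thus treat both kinds of tuples
  alike.\<close>

lemma Glev_Suc_Suc_cases:
  assumes "g \<in> Glev X (Suc (Suc n))"
  obtains l a c b r s t where "g = Tup l a c b r"
    "l \<in> Glev X (Suc n)" "a \<in> Anc X" "c \<in> Glev X n" "b \<in> Anc X" "r \<in> Glev X (Suc n)"
    "c = selE s l" "a = ainv (selA s l)" "c = selE t r" "b = ainv (selA t r)"
proof (cases "g \<in> GE X (Suc (Suc n))")
  case True
  then obtain h where h: "h \<in> GE X (Suc n)"
    "g = Tup h (ainv (aL h)) (eL h) (ainv (aR h)) h \<or>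
     g = Tup h (ainv (aR h)) (eL h) (ainv (aL h)) h"
    by auto
  note sides = GE_sides[OF h(1)]
  have h': "h \<in> Glev X (Suc n)" using h(1) GE_subset_Glev by blast
  from h(2) show ?thesis
  proof
    assume eq: "g = Tup h (ainv (aL h)) (eL h) (ainv (aR h)) h"
    show ?thesis
      by (rule that[OF eq, of True False]) (use h' sides in \<open>simp_all add: selE_def selA_def ainv_Anc\<close>)
  next
    assume eq: "g = Tup h (ainv (aR h)) (eL h) (ainv (aL h)) h"
    show ?thesis
      by (rule that[OF eq, of False True]) (use h' sides in \<open>simp_all add: selE_def selA_def ainv_Anc\<close>)
  qed
next
  case False
  with assms have "\<exists>l a c b r. g = Tup l a c b r \<and> l \<in> Glev X (Suc n) \<and> a \<in> Anc X \<and>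
    c \<in> Glev X n \<and> b \<in> Anc X \<and> r \<in> Glev X (Suc n) \<and> l \<noteq> r \<and>
    (\<exists>s. c = selE s l \<and> a = ainv (selA s l)) \<and> (\<exists>t. c = selE t r \<and> b = ainv (selA t r))"
    unfolding Glev.simps by blast
  then show ?thesis by (elim exE conjE) (rule that)
qed

lemma Glev_sides:
  assumes "g \<in> Glev X (Suc n)"
  shows "selE s g \<in> Glev X n" "selA s g \<in> Anc X"
proof -
  have "selE s g \<in> Glev X n \<and> selA s g \<in> Anc X"
  proof (cases n)
    case 0
    with assms GE_sides[of g X 1] show ?thesis by (auto simp: selE_def selA_def)
  next
    case (Suc m)
    with assms show ?thesis
      by (auto elim!: Glev_Suc_Suc_cases simp: selE_def selA_def simp del: Glev.simps)
  qed
  then show "selE s g \<in> Glev X n" "selA s g \<in> Anc X" by auto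
qed

fun height :: "'x sym \<Rightarrow> nat" where
  "height (Tup l a c b r) = Suc (height l)"
| "height _ = 0"

lemma height_Glev: "g \<in> Glev X n \<Longrightarrow> height g = n"
proof (induction n arbitrary: g)
  case (Suc n)
  show ?case
  proof (cases n)
    case 0
    with Suc.prems show ?thesis by (auto simp: gxx_def)
  next
    case (Suc m)
    with Suc.IH Suc.prems show ?thesis by (auto elim!: Glev_Suc_Suc_cases simp del: Glev.simps)
  qed
qed simp

text \<open>The case \<open>l = r\<close>, \<open>s \<noteq> t\<close> forces \<open>l\<close> into \<open>GE X\<close>, since both side entries of \<open>l\<close> equal \<open>c\<close>.\<close>

lemma Tup_in_Glev:
  assumes l: "l \<in> Glev X (Suc n)" and r: "r \<in> Glev X (Suc n)"
    and c: "selE s l = c" "selE t r = c" and ne: "l \<noteq> r \<or> s \<noteq> t"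
  shows "Tup l (ainv (selA s l)) c (ainv (selA t r)) r \<in> Glev X (Suc (Suc n))"
proof (cases "l = r")
  case False
  have "c \<in> Glev X n" using Glev_sides(1)[OF l, of s] c by simp
  moreover have "ainv (selA s l) \<in> Anc X" "ainv (selA t r) \<in> Anc X"
    using Glev_sides(2)[OF l] Glev_sides(2)[OF r] by (auto intro: ainv_Anc)
  ultimately show ?thesis using False l r c by (auto intro: exI[of _ s] exI[of _ t])
next
  case True
  with ne have st: "s \<noteq> t" by simp
  have eq: "eL l = c" "eR l = c" using c st True by (auto simp: selE_def split: if_splits)
  have "l \<in> GE X (Suc n)"
  proof (cases n)
    case 0
    with l show ?thesis by simp
  next
    case (Suc m)
    with l eq show ?thesis by auto
  qed
  then show ?thesis using st True eq by (cases s) (auto simp: selA_def)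
qed

section \<open>Evaluating symbols in a regular monoid\<close>

locale regular_monoid =
  fixes emb :: "'x \<Rightarrow> 'm::monoid_mult"
  assumes regular: "\<exists>t. s * t * s = (s::'m)"
begin

definition pinv :: "'m \<Rightarrow> 'm" where
  "pinv s = (SOME t. s * t * s = s \<and> t * s * t = t)"

lemma pinv: "s * pinv s * s = s" "pinv s * s * pinv s = pinv s"
proof -
  obtain t where t: "s * t * s = s" using regular by blast
  have "s * (t * s * t) * s = s \<and> (t * s * t) * s * (t * s * t) = t * s * t"
    by (simp add: mult.assoc t[unfolded mult.assoc] t[THEN mult_ext, unfolded mult.assoc])
  then have "s * pinv s * s = s \<and> pinv s * s * pinv s = pinv s"
    unfolding pinv_def by (rule someI)
  then show "s * pinv s * s = s" "pinv s * s * pinv s = pinv s" by auto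
qed

text \<open>Kept apart from \<open>val\<close> because the recursion for \<open>val\<close> must
  evaluate \<open>ainv a\<close>, which is not a subterm of the tuple.\<close>

fun aval :: "'x sym \<Rightarrow> 'm" where
  "aval (Pos x) = emb x"
| "aval (Neg x) = pinv (emb x)"
| "aval _ = 1"

text \<open>For idempotents \<open>e\<close> and \<open>f\<close> this is one element of
  Nambooripad's sandwich set, the idempotents \<open>h\<close> with \<open>h * e = h = f * h\<close>
  and \<open>e * h * f = e * f\<close>.\<close>

definition sandwich :: "'m \<Rightarrow> 'm \<Rightarrow> 'm" where
  "sandwich e f = f * pinv (e * f) * e"

text \<open>Among the tuples of \<open>G5 X\<close>, those with left entry \<open>One\<close> are exactly the \<open>gxx x\<close>.\<close>

primrec val :: "'x sym \<Rightarrow> 'm" where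
  "val One = 1"
| "val (Pos x) = emb x"
| "val (Neg x) = pinv (emb x)"
| "val (XX x) = emb x * pinv (emb x)"
| "val (Tup l a c b r) = (if l = One then val c else
     sandwich (aval (ainv b) * val r * aval b * val c) (val c * aval (ainv a) * val l * aval a))"

text \<open>The value of \<open>g\<^sup>L\<close> for \<open>s = True\<close> and of
  \<open>g\<^sup>R\<close> for \<open>s = False\<close>.\<close>

definition side :: "bool \<Rightarrow> 'x sym \<Rightarrow> 'm" where
  "side s g = aval (ainv (selA s g)) * val (selE s g) * aval (selA s g)"

lemma val_anchor: "a \<in> Anc X \<Longrightarrow> val a = aval a"
  by (auto simp: Anc_def)

lemma sandwich_mult:
  assumes e: "e * e = e" and f: "f * f = f"
  shows "sandwich e f * sandwich e f = sandwich e f"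
    "sandwich e f * e = sandwich e f" "f * sandwich e f = sandwich e f"
    "e * sandwich e f * f = e * f"
proof -
  show "sandwich e f * sandwich e f = sandwich e f"
    unfolding sandwich_def by (simp add: mult.assoc pinv(2)[of "e * f", unfolded mult.assoc] pinv(2)[of "e * f", THEN mult_ext, unfolded mult.assoc])
  show "sandwich e f * e = sandwich e f" "f * sandwich e f = sandwich e f"
    unfolding sandwich_def by (simp_all add: mult.assoc e f[THEN mult_ext, unfolded mult.assoc])
  show "e * sandwich e f * f = e * f"
    unfolding sandwich_def by (simp add: mult.assoc pinv(1)[of "e * f", unfolded mult.assoc] pinv(1)[of "e * f", THEN mult_ext, unfolded mult.assoc])
qed

text \<open>The second condition has two uses: one level higher it makes the arguments of
  \<open>sandwich\<close> idempotent, and it lets a descent followed by its reversal cancel.\<close>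

definition good :: "'x sym \<Rightarrow> bool" where
  "good g \<longleftrightarrow> val g * val g = val g \<and> (\<forall>s. val g * side s g * val g = val g)"

text \<open>In the next lemma \<open>p = g\<^sup>R\<close> and \<open>q = g\<^sup>L\<close>.\<close>

lemma sandwich_relations:
  assumes c: "c * c = c" and e: "p * c * (p * c) = p * c" and f: "c * q * (c * q) = c * q"
    and g: "g = sandwich (p * c) (c * q)"
  shows "g * g = g" "c * q * g = g" "g * p * c = g" "p * g * q = p * c * q"
    "g * q * g = g" "g * p * g = g"
proof -
  note sw = sandwich_mult[OF e f, folded g]
  show gg: "g * g = g" by (fact sw(1))
  show cqg: "c * q * g = g" by (fact sw(3))
  show gpc: "g * p * c = g" using sw(2) by (simp add: mult.assoc)
  have cg: "c * g = g"
    using mult_ext[OF c, of "q * g"] cqg by (simp add: mult.assoc)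
  have gc: "g * c = g"
    using arg_cong[OF c, of "\<lambda>z. g * p * z"] gpc by (simp flip: mult.assoc)
  have "p * g * q = p * c * g * (c * q)"
    by (simp add: mult.assoc cg[THEN mult_ext, unfolded mult.assoc] gc[THEN mult_ext, unfolded mult.assoc])
  also have "\<dots> = p * c * (c * q)" using sw(4) by simp
  also have "\<dots> = p * c * q" by (simp add: mult.assoc c[THEN mult_ext, unfolded mult.assoc])
  finally show "p * g * q = p * c * q" .
  have "g * q * g = g * (c * q * g)" by (simp add: mult.assoc gc[THEN mult_ext, unfolded mult.assoc])
  then show "g * q * g = g" using gg cqg by simp
  have "g * p * g = (g * p * c) * g" by (simp add: mult.assoc cg)
  then show "g * p * g = g" using gg gpc by simp
qed

text \<open>Since \<open>c\<close> is a side entry of both \<open>l\<close> and \<open>r\<close>,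
  their goodness says that \<open>l a c a' l = l\<close> and \<open>r b c b' r = r\<close> hold for
  the values. This makes \<open>c g\<^sup>L\<close> and \<open>g\<^sup>R c\<close> idempotent, so
  the sandwich identities apply.\<close>

lemma good_Suc_Suc:
  assumes g: "g = Tup l a c b r" and l: "l \<in> Glev X (Suc n)" and r: "r \<in> Glev X (Suc n)"
    and s: "c = selE s l" "a = ainv (selA s l)" and t: "c = selE t r" "b = ainv (selA t r)"
    and cc: "val c * val c = val c" and gl: "good l" and gr: "good r"
  shows "good g" "val c * side True g * val g = val g" "val g * side False g * val c = val g"
    "side False g * val g * side True g = side False g * val c * side True g"
proof -
  have sT: "side True g = aval (ainv a) * val l * aval a"
    and sF: "side False g = aval (ainv b) * val r * aval b"
    by (simp_all add: g side_def selE_def selA_def)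
  have ia: "ainv a = selA s l" and ib: "ainv b = selA t r"
    using s t Glev_sides(2)[OF l] Glev_sides(2)[OF r] by (auto intro: ainv_ainv)
  have ll: "val l * aval a * val c * aval (ainv a) * val l = val l"
    using gl s unfolding good_def side_def ia by (simp add: mult.assoc)
  have rr: "val r * aval b * val c * aval (ainv b) * val r = val r"
    using gr t unfolding good_def side_def ib by (simp add: mult.assoc)
  have f: "val c * side True g * (val c * side True g) = val c * side True g"
    unfolding sT by (simp add: mult.assoc ll[THEN mult_ext, unfolded mult.assoc])
  have e: "side False g * val c * (side False g * val c) = side False g * val c"
    unfolding sF by (simp add: mult.assoc rr[THEN mult_ext, unfolded mult.assoc])
  \<comment> \<open>Rules out the branch of \<open>val\<close> meant for \<open>gxx\<close>.\<close>
  have "l \<noteq> One" using l height_Glev[OF l] by auto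
  then have "val g = sandwich (side False g * val c) (val c * side True g)"
    unfolding sT sF by (simp add: g mult.assoc)
  note rel = sandwich_relations[OF cc e f this]
  show "good g" unfolding good_def
  proof (intro conjI allI)
    show "val g * side u g * val g = val g" for u
      using rel(5,6) by (cases u) auto
  qed (fact rel(1))
  show "val c * side True g * val g = val g" "val g * side False g * val c = val g"
    "side False g * val g * side True g = side False g * val c * side True g"
    by (fact rel)+
qed

lemma good_gxx: "good (gxx x)"
  using pinv(1)[of "emb x", THEN mult_ext, unfolded mult.assoc]
  by (simp add: good_def gxx_def side_def selE_def selA_def all_bool_eq mult.assoc)

text \<open>Two consecutive levels are carried along because the middle entry of a tuple lies two
  levels below it. That entry need only be idempotent; it may be \<open>One\<close>, which has no
  sides.\<close>

lemma Glev_good: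
  "(\<forall>g\<in>Glev X n. val g * val g = val g) \<and> (\<forall>g\<in>Glev X (Suc n). good g)"
proof (induction n)
  case 0
  then show ?case using good_gxx by auto
next
  case (Suc n)
  have "good g" if "g \<in> Glev X (Suc (Suc n))" for g
    using that
  proof (rule Glev_Suc_Suc_cases)
    fix l a c b r s t
    assume *: "g = Tup l a c b r" "l \<in> Glev X (Suc n)" "r \<in> Glev X (Suc n)"
      "c = selE s l" "a = ainv (selA s l)" "c = selE t r" "b = ainv (selA t r)"
      and c: "c \<in> Glev X n"
    have "val c * val c = val c" "good l" "good r" using Suc.IH *(2,3) c by blast+
    then show "good g" by (rule good_Suc_Suc(1)[OF *])
  qed
  moreover have "val g * val g = val g" if "g \<in> Glev X (Suc n)" for g
    using Suc.IH that good_def by blast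
  ultimately show ?case by blast
qed

lemma val_idem: "g \<in> Glev X n \<Longrightarrow> val g * val g = val g"
  using Glev_good by blast

lemma good_Glev: "g \<in> Glev X (Suc n) \<Longrightarrow> good g"
  using Glev_good by blast

lemma val_relations:
  assumes "g \<in> Glev X (Suc (Suc n))"
  shows "val (eC g) * side True g * val g = val g" "val g * side False g * val (eC g) = val g"
    "side False g * val g * side True g = side False g * val (eC g) * side True g"
proof -
  have "val (eC g) * side True g * val g = val g \<and> val g * side False g * val (eC g) = val g \<and>
    side False g * val g * side True g = side False g * val (eC g) * side True g"
    using assms
  proof (rule Glev_Suc_Suc_cases)
    fix l a c b r s t
    assume *: "g = Tup l a c b r" "l \<in> Glev X (Suc n)" "r \<in> Glev X (Suc n)"
      "c = selE s l" "a = ainv (selA s l)" "c = selE t r" "b = ainv (selA t r)"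
      and c: "c \<in> Glev X n"
    show ?thesis
      using good_Suc_Suc(2-4)[OF * val_idem[OF c] good_Glev[OF *(2)] good_Glev[OF *(3)]] *(1)
      by simp
  qed
  then show "val (eC g) * side True g * val g = val g"
    "val g * side False g * val (eC g) = val g"
    "side False g * val g * side True g = side False g * val (eC g) * side True g" by auto
qed

section \<open>Invariance of word values under \<open>rho\<close>\<close>

definition wval :: "'x sym list \<Rightarrow> 'm" where
  "wval w = prod_list (map val w)"

lemma wval_simps [simp]:
  "wval [] = 1" "wval (g # w) = val g * wval w" "wval (u @ w) = wval u * wval w"
  by (simp_all add: wval_def)

lemma wval_wL_wR:
  assumes "g \<in> Glev X (Suc n)"
  shows "wval (wL g) = side True g" "wval (wR g) = side False g"
  using Glev_sides[OF assms, of True] Glev_sides[OF assms, of False]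
  by (auto simp: wL_def wR_def side_def selE_def selA_def mult.assoc val_anchor[OF ainv_Anc]
      val_anchor)

lemma G5h2_cases:
  assumes "g \<in> G5h2 X"
  obtains n where "g \<in> Glev X (Suc (Suc n))"
  using assms unfolding G5h2_def by (auto dest!: le_Suc_ex)

lemma wval_Rgen:
  assumes "(u, v) \<in> Rgen X"
  shows "wval u = wval v"
proof -
  have idem: "val g * val g = val g" if "g \<in> Gp X" for g
    using that val_idem unfolding Gp_def G5_def by (auto dest: val_idem)
  have rel: "wval ([eC g] @ wL g @ [g]) = wval [g] \<and> wval ([g] @ wR g @ [eC g]) = wval [g] \<and>
    wval (wR g @ [g] @ wL g) = wval (wR g @ [eC g] @ wL g)" if "g \<in> G5h2 X" for g
    using that
  proof (rule G5h2_cases)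
    fix n assume g: "g \<in> Glev X (Suc (Suc n))"
    show ?thesis using val_relations[OF g] by (simp add: wval_wL_wR[OF g] mult.assoc)
  qed
  show ?thesis
    using assms rel idem pinv unfolding Rgen_def by (auto simp: gxx_def mult.assoc)
qed

lemma wval_rho: "rho X u v \<Longrightarrow> wval u = wval v"
  by (induction rule: rho.induct) (auto simp: wval_Rgen)

section \<open>Paths between tuples and their side entries\<close>

text \<open>Values of paths in the Hasse diagram of \<open>Glev X\<close>, including both end points.\<close>

definition up_step :: "'x sym \<Rightarrow> bool \<Rightarrow> 'm" where
  "up_step k s = val (selE s k) * aval (selA s k) * val k"

definition down_step :: "'x sym \<Rightarrow> bool \<Rightarrow> 'm" where
  "down_step k s = val k * aval (ainv (selA s k)) * val (selE s k)"

inductive up :: "'x set \<Rightarrow> 'x sym \<Rightarrow> 'x sym \<Rightarrow> 'm \<Rightarrow> bool" for X where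
  up_refl: "g \<in> Glev X n \<Longrightarrow> up X g g (val g)"
| up_into: "up X g (selE s k) p \<Longrightarrow> k \<in> Glev X (Suc n) \<Longrightarrow> up X g k (p * up_step k s)"

inductive down :: "'x set \<Rightarrow> 'x sym \<Rightarrow> 'x sym \<Rightarrow> 'm \<Rightarrow> bool" for X where
  down_refl: "g \<in> Glev X n \<Longrightarrow> down X g g (val g)"
| down_into: "down X g k p \<Longrightarrow> k \<in> Glev X (Suc n) \<Longrightarrow> down X g (selE s k) (p * down_step k s)"

lemma step_ends:
  assumes "k \<in> Glev X (Suc n)"
  shows "val (selE s k) * up_step k s = up_step k s" "up_step k s * val k = up_step k s"
    "val k * down_step k s = down_step k s" "down_step k s * val (selE s k) = down_step k s"
  unfolding up_step_def down_step_def
  by (simp_all add: mult.assoc val_idem[OF assms] val_idem[OF Glev_sides(1)[OF assms]]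
      val_idem[OF assms, THEN mult_ext, unfolded mult.assoc]
      val_idem[OF Glev_sides(1)[OF assms], THEN mult_ext, unfolded mult.assoc])

lemma up_ends: "up X g k p \<Longrightarrow> val g * p = p \<and> p * val k = p"
proof (induction rule: up.induct)
  case (up_refl g n)
  then show ?case using val_idem by blast
next
  case up_into
  then show ?case
    by (simp add: mult.assoc step_ends) (simp flip: mult.assoc)
qed

lemma down_ends: "down X g k p \<Longrightarrow> val g * p = p \<and> p * val k = p"
proof (induction rule: down.induct)
  case (down_refl g n)
  then show ?case using val_idem by blast
next
  case down_into
  then show ?case
    by (simp add: mult.assoc step_ends) (simp flip: mult.assoc)
qed

lemma up_trans: "up X h k q \<Longrightarrow> up X g h p \<Longrightarrow> up X g k (p * q)"
proof (induction rule: up.induct)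
  case (up_refl g n)
  then show ?case using up_ends by simp
next
  case (up_into h s k q n)
  then show ?case using up.up_into[of X g s k "p * q" n] by (simp add: mult.assoc)
qed

lemma down_trans: "down X h k q \<Longrightarrow> down X g h p \<Longrightarrow> down X g k (p * q)"
proof (induction rule: down.induct)
  case (down_refl g n)
  then show ?case using down_ends by simp
next
  case (down_into h k q n s)
  then show ?case using down.down_into[of X g k "p * q" n s] by (simp add: mult.assoc)
qed

lemma up_single: "k \<in> Glev X (Suc n) \<Longrightarrow> up X (selE s k) k (up_step k s)"
  using up_into[OF up_refl[OF Glev_sides(1)]] step_ends(1) by metis

lemma down_single: "k \<in> Glev X (Suc n) \<Longrightarrow> down X k (selE s k) (down_step k s)"
  using down_into[OF down_refl] step_ends(3) by metis

lemma down_up_step: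
  assumes "k \<in> Glev X (Suc n)"
  shows "down_step k s * up_step k s = val k"
proof -
  have "down_step k s * up_step k s = val k * side s k * val k"
    unfolding down_step_def up_step_def side_def
    by (simp add: mult.assoc val_idem[OF Glev_sides(1)[OF assms], THEN mult_ext, unfolded mult.assoc])
  then show ?thesis using good_Glev[OF assms] by (simp add: good_def)
qed

text \<open>If both walls are the same side of the same tuple, the valley cancels. Otherwise, even
  for the two sides of one tuple, some tuple \<open>k\<close> spans the walls, and
  \<open>g\<^sup>R g g\<^sup>L = g\<^sup>R g\<^sup>c g\<^sup>L\<close> turns the valley into a
  hill.\<close>

lemma valley:
  assumes r: "r \<in> Glev X (Suc m)" and l: "l \<in> Glev X (Suc n)" and eq: "selE t r = selE s l"
  shows "(l = r \<and> down_step r t * up_step l s = val r) \<or>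
    (\<exists>k. k \<in> Glev X (Suc (Suc n)) \<and> selE False k = r \<and> selE True k = l \<and>
      down_step r t * up_step l s = up_step k False * down_step k True)"
proof (cases "l = r \<and> s = t")
  case True
  then show ?thesis using down_up_step[OF r] by simp
next
  case False
  define c where "c = selE s l"
  have mn: "m = n"
    using height_Glev[OF Glev_sides(1)[OF r, of t]] height_Glev[OF Glev_sides(1)[OF l, of s]] eq
    by simp
  \<comment> \<open>The path runs from \<open>r\<close> to \<open>l\<close>, yet \<open>l\<close> is
    the left entry, as \<open>g\<^sup>R\<close> precedes \<open>g\<^sup>L\<close> in the relation.
    With inverted anchors, the climb from \<open>r\<close> to \<open>k\<close> reads the same anchor
    as the descent from \<open>r\<close>.\<close>
  define k where "k = Tup l (ainv (selA s l)) c (ainv (selA t r)) r"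
  have k: "k \<in> Glev X (Suc (Suc n))"
    unfolding k_def using False eq mn r by (intro Tup_in_Glev[OF l]) (auto simp: c_def)
  have sel [simp]: "selE True k = l" "selE False k = r"
    "selA True k = ainv (selA s l)" "selA False k = ainv (selA t r)" "eC k = c"
    by (simp_all add: k_def selE_def selA_def)
  let ?a = "aval (ainv (selA s l))" and ?a' = "aval (selA s l)"
  let ?b = "aval (ainv (selA t r))" and ?b' = "aval (selA t r)"
  have ii: "ainv (ainv (selA s l)) = selA s l" "ainv (ainv (selA t r)) = selA t r"
    using Glev_sides(2)[OF l] Glev_sides(2)[OF r] by (auto intro: ainv_ainv)
  have L: "val l * ?a * val c * ?a' * val l = val l"
    using good_Glev[OF l] unfolding good_def side_def c_def by (simp add: mult.assoc)
  have R: "val r * ?b * val c * ?b' * val r = val r"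
    using good_Glev[OF r] unfolding good_def side_def c_def eq[symmetric] by (simp add: mult.assoc)
  have key: "?b' * val r * ?b * val k * (?a' * val l * ?a) = ?b' * val r * ?b * val c * (?a' * val l * ?a)"
    using val_relations(3)[OF k] by (simp add: side_def ii)
  text \<open>\<open>L\<close> and \<open>R\<close> cancel the outer anchors of \<open>g\<^sup>R g g\<^sup>L = g\<^sup>R g\<^sup>c g\<^sup>L\<close>.\<close>
  have "down_step r t * up_step l s = val r * ?b * val c * ?a' * val l"
    unfolding down_step_def up_step_def eq c_def
    by (simp add: mult.assoc val_idem[OF Glev_sides(1)[OF l], THEN mult_ext, unfolded mult.assoc])
  also have "\<dots> = (val r * ?b * val c * ?b' * val r) * ?b * val c * ?a' * (val l * ?a * val c * ?a' * val l)"
    by (simp only: L R)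
  also have "\<dots> = val r * ?b * val c * (?b' * val r * ?b * val c * (?a' * val l * ?a)) * val c * ?a' * val l"
    by (simp add: mult.assoc)
  also have "\<dots> = val r * ?b * val c * (?b' * val r * ?b * val k * (?a' * val l * ?a)) * val c * ?a' * val l"
    by (simp only: key)
  also have "\<dots> = (val r * ?b * val c * ?b' * val r) * ?b * val k * ?a' * (val l * ?a * val c * ?a' * val l)"
    by (simp add: mult.assoc)
  also have "\<dots> = val r * ?b * val k * ?a' * val l"
    by (simp only: L R)
  also have "\<dots> = up_step k False * down_step k True"
    unfolding up_step_def down_step_def sel ii
    by (simp add: mult.assoc val_idem[OF k, THEN mult_ext, unfolded mult.assoc])
  finally show ?thesis using k sel by blast
qed

text \<open>Induction on the descent. At its last step, \<open>valley\<close> either cancels or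
  trades the climb to \<open>h\<close> for a climb from \<open>r\<close> to some \<open>k\<close>
  and one step down to \<open>h\<close>; the induction hypothesis moves the climb to
  \<open>k\<close> past the shorter descent to \<open>r\<close>.\<close>

lemma down_up_step_commute:
  "down X g c p \<Longrightarrow> h \<in> Glev X (Suc n) \<Longrightarrow> c = selE s h \<Longrightarrow>
   \<exists>k q' p'. up X g k q' \<and> down X k h p' \<and> p * up_step h s = q' * p'"
proof (induction arbitrary: h s n rule: down.induct)
  case (down_refl g m)
  then have "up X g h (up_step h s)" "down X h h (val h)"
    "val g * up_step h s = up_step h s * val h"
    using up_single down.down_refl step_ends by auto
  then show ?case by blast
next
  case (down_into g r p m t)
  from valley[OF down_into.hyps(2) down_into.prems]
  consider "h = r" "down_step r t * up_step h s = val r"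
    | k where "k \<in> Glev X (Suc (Suc n))" "selE False k = r" "selE True k = h"
      "down_step r t * up_step h s = up_step k False * down_step k True"
    by blast
  then show ?case
  proof cases
    case 1
    have g: "\<exists>n. g \<in> Glev X n"
      using down_into.hyps(1) by (induction rule: down.induct) auto
    have "p * down_step r t * up_step h s = val g * p"
      using 1(2) down_ends[OF down_into.hyps(1)] by (simp add: mult.assoc)
    with 1(1) g down_into.hyps(1) up_refl show ?thesis by blast
  next
    case (2 k)
    obtain k' q' p' where *: "up X g k' q'" "down X k' k p'" "p * up_step k False = q' * p'"
      using down_into.IH[OF 2(1) 2(2)[symmetric]] by blast
    have "down X k' h (p' * down_step k True)"
      using down.down_into[OF *(2) 2(1), of True] 2(3) by simp
    moreover have "p * down_step r t * up_step h s = q' * (p' * down_step k True)"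
      by (simp add: mult.assoc 2(4) *(3)[THEN mult_ext, unfolded mult.assoc])
    ultimately show ?thesis using *(1) by blast
  qed
qed

text \<open>The steps of the ascent cross the descent one at a time; the descent left by one step is
  the input for the next.\<close>

lemma down_up_commute:
  "up X c h q \<Longrightarrow> down X g c p \<Longrightarrow>
   \<exists>k q' p'. up X g k q' \<and> down X k h p' \<and> p * q = q' * p'"
proof (induction rule: up.induct)
  case (up_refl c n)
  have "\<exists>n. g \<in> Glev X n"
    using up_refl(2) by (induction rule: down.induct) auto
  moreover have "p * val c = val g * p" using down_ends[OF up_refl(2)] by simp
  ultimately show ?case using up_refl(2) up.up_refl by blast
next
  case (up_into c s h q n)
  then obtain k q' p' where *: "up X g k q'" "down X k (selE s h) p'" "p * q = q' * p'" by blast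
  obtain k2 q2 p2 where **: "up X k k2 q2" "down X k2 h p2" "p' * up_step h s = q2 * p2"
    using down_up_step_commute[OF *(2) up_into.hyps(2)] by blast
  have "p * (q * up_step h s) = q' * q2 * p2" by (simp add: mult.assoc *(3)[THEN mult_ext, unfolded mult.assoc] **(3))
  with up_trans[OF **(1) *(1)] **(2) show ?case by blast
qed

text \<open>Here and in \<open>up_reverse\<close> the descent comes first in the product, so
  \<open>down_up_step\<close> cancels from the lowest point outwards.\<close>

lemma down_reverse: "down X k g p \<Longrightarrow> \<exists>q. up X g k q \<and> p * q = val k"
proof (induction rule: down.induct)
  case (down_refl g n)
  then show ?case using up_refl val_idem by blast
next
  case (down_into g k p n s)
  then obtain q where q: "up X k g q" "p * q = val g" by blast
  have "p * down_step k s * (up_step k s * q) = p * (down_step k s * up_step k s) * q"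
    by (simp add: mult.assoc)
  also have "\<dots> = val g"
    using down_up_step[OF down_into.hyps(2)] down_ends[OF down_into.hyps(1)] q(2) by simp
  finally show ?case using up_trans[OF q(1) up_single[OF down_into.hyps(2)]] by blast
qed

lemma up_reverse: "up X g k q \<Longrightarrow> \<exists>p. down X k g p \<and> p * q = val k"
proof (induction rule: up.induct)
  case (up_refl g n)
  then show ?case using down_refl val_idem by blast
next
  case (up_into g s k q n)
  then obtain p where p: "down X (selE s k) g p" "p * q = val (selE s k)" by blast
  have "down_step k s * p * (q * up_step k s) = down_step k s * (p * q) * up_step k s"
    by (simp add: mult.assoc)
  also have "\<dots> = val k"
    using down_up_step[OF up_into.hyps(2)] step_ends(4)[OF up_into.hyps(2)] p(2) by simp
  finally show ?case using down_trans[OF p(1) down_single[OF up_into.hyps(2)]] by blast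
qed

section \<open>Mountains form a regular subsemigroup\<close>

definition mountains :: "'x set \<Rightarrow> 'm set" where
  "mountains X = {q * p | q p k. up X One k q \<and> down X k One p}"

text \<open>The descent of the first mountain meets the ascent of the second at \<open>One\<close>;
  exchanging them merges both mountains into one.\<close>

lemma mountains_mult:
  assumes "a \<in> mountains X" "b \<in> mountains X"
  shows "a * b \<in> mountains X"
proof -
  obtain q1 p1 k1 where 1: "a = q1 * p1" "up X One k1 q1" "down X k1 One p1"
    using assms(1) unfolding mountains_def by blast
  obtain q2 p2 k2 where 2: "b = q2 * p2" "up X One k2 q2" "down X k2 One p2"
    using assms(2) unfolding mountains_def by blast
  obtain k q p where 3: "up X k1 k q" "down X k k2 p" "p1 * q2 = q * p"
    using down_up_commute[OF 2(2) 1(3)] by blast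
  have "a * b = (q1 * q) * (p * p2)" by (simp add: 1(1) 2(1) mult.assoc 3(3)[THEN mult_ext, unfolded mult.assoc])
  then show ?thesis
    using up_trans[OF 3(1) 1(2)] down_trans[OF 2(3) 3(2)] unfolding mountains_def by blast
qed

lemma mountains_regular:
  assumes "a \<in> mountains X"
  shows "\<exists>b\<in>mountains X. a * b * a = a"
proof -
  obtain q p k where *: "a = q * p" "up X One k q" "down X k One p"
    using assms unfolding mountains_def by blast
  obtain q' where q': "up X One k q'" "p * q' = val k" using down_reverse[OF *(3)] by blast
  obtain p' where p': "down X k One p'" "p' * q = val k" using up_reverse[OF *(2)] by blast
  \<comment> \<open>\<open>q' * p'\<close> is the mountain traversed backwards.\<close>
  have "a * (q' * p') * a = q * (p * q') * (p' * q) * p" using *(1) by (simp add: mult.assoc)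
  also have "\<dots> = a" using q' p' up_ends[OF *(2)] *(1) by simp
  finally show ?thesis using q'(1) p'(1) unfolding mountains_def by blast
qed

text \<open>The mountain climbs to \<open>gxx x\<close> on the left, where the anchor is 1, and
  descends on the right, where the inverted anchor is \<open>x\<close>. Its value is
  \<open>x x' x x' x = x\<close>.\<close>

lemma emb_in_mountains:
  assumes "x \<in> X"
  shows "emb x \<in> mountains X"
proof -
  have g: "gxx x \<in> Glev X (Suc 0)" using assms by simp
  have "up X One (gxx x) (up_step (gxx x) True)" "down X (gxx x) One (down_step (gxx x) False)"
    using up_single[OF g, of True] down_single[OF g, of False] by (simp_all add: gxx_def selE_def)
  moreover have "up_step (gxx x) True * down_step (gxx x) False = emb x"
    using pinv[of "emb x"] by (simp add: up_step_def down_step_def gxx_def selE_def selA_def)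
  ultimately show ?thesis unfolding mountains_def by force
qed

section \<open>From mountain values to words\<close>

definition word_values :: "'x set \<Rightarrow> 'm set" where
  "word_values X = wval ` lists (Gen X)"

lemma word_values_mult: "a \<in> word_values X \<Longrightarrow> b \<in> word_values X \<Longrightarrow> a * b \<in> word_values X"
  unfolding word_values_def by (auto simp flip: wval_simps(3) intro!: imageI)

lemma val_word_values: "g \<in> Gen X \<Longrightarrow> val g \<in> word_values X"
  unfolding word_values_def by (rule image_eqI[of _ _ "[g]"]) auto

lemma Glev_Gen: "g \<in> Glev X n \<Longrightarrow> g \<in> Gen X"
  by (cases n) (auto simp: Gen_def G5_def Anc_def simp del: Glev.simps(2,3))

lemma step_word_values:
  assumes k: "k \<in> Glev X (Suc n)"
  shows "up_step k s \<in> word_values X" "down_step k s \<in> word_values X"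
proof -
  have "aval a \<in> word_values X" if "a \<in> Anc X" for a
    using that val_word_values[of a X] by (simp add: Gen_def val_anchor)
  then show "up_step k s \<in> word_values X" "down_step k s \<in> word_values X"
    unfolding up_step_def down_step_def
    using Glev_sides[OF k, of s] k
    by (auto intro!: word_values_mult val_word_values ainv_Anc intro: Glev_Gen)
qed

lemma mountains_word_values: "mountains X \<subseteq> word_values X"
proof -
  have "p \<in> word_values X" if "up X g k p" for g k p
    using that by (induction rule: up.induct)
      (auto intro: word_values_mult val_word_values Glev_Gen step_word_values)
  moreover have "p \<in> word_values X" if "down X g k p" for g k p
    using that by (induction rule: down.induct)
      (auto intro: word_values_mult val_word_values Glev_Gen step_word_values)
  ultimately show ?thesis unfolding mountains_def by (auto intro: word_values_mult)
qed

text \<open>Letters \<open>One\<close> have value 1 and can be deleted; \<open>a \<noteq> 1\<close>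
  ensures that some letter remains.\<close>

lemma word_values_FXwords:
  assumes "a \<in> word_values X" "a \<noteq> 1"
  shows "a \<in> wval ` FXwords X"
proof -
  obtain w where w: "w \<in> lists (Gen X)" "a = wval w"
    using assms(1) unfolding word_values_def by blast
  let ?w = "filter (\<lambda>g. g \<noteq> One) w"
  have eq: "wval ?w = wval w" by (induction w) auto
  with assms(2) w(2) have "?w \<noteq> []" by auto
  then have "?w \<in> FXwords X" using w(1) unfolding FXwords_def by auto
  then show ?thesis using eq w(2) by (metis image_eqI)
qed

end

section \<open>The homomorphism onto the given semigroup\<close>

text \<open>A product is \<open>Unit\<close> only if all its factors are. The value of a tuple of
  height at least 2 has the value of its left entry as a factor, so induction leads down to
  \<open>emb x * pinv (emb x)\<close>.\<close>

lemma val_ne_Unit: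
  fixes X :: "'a::semigroup_mult set"
  assumes S: "regular_sg (UNIV :: 'a set)" and g: "g \<in> Gen X - {One}"
  shows "regular_monoid.val Elem g \<noteq> Unit"
proof -
  interpret regular_monoid "Elem :: 'a \<Rightarrow> 'a with_one"
    by unfold_locales (rule with_one_regular[OF S])
  note Unit_iff = with_one_mult_eq_Unit_iff
  have inv: "pinv (Elem x) \<noteq> Unit" for x
    using pinv(2)[of "Elem x"] by (metis Unit_iff with_one.distinct(1))
  have lev: "val h \<noteq> Unit" if "h \<in> Glev X (Suc n)" for h n
    using that
  proof (induction n arbitrary: h)
    case 0
    then show ?case by (auto simp: gxx_def Unit_iff)
  next
    case (Suc n)
    from Suc.prems show ?case
    proof (rule Glev_Suc_Suc_cases)
      fix l a c b r
      assume h: "h = Tup l a c b r" and l: "l \<in> Glev X (Suc n)"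
      have "l \<noteq> One" using height_Glev[OF l] by auto
      then show ?thesis using Suc.IH[OF l] h by (simp add: sandwich_def Unit_iff)
    qed
  qed
  from g consider n where "g \<in> Glev X (Suc n)" | "g \<in> Anc X - {One}"
    unfolding Gen_def G5_def by (auto simp: Suc_le_eq dest!: gr0_implies_Suc)
  then show ?thesis
  proof cases
    case 1
    then show ?thesis by (rule lev)
  next
    case 2
    then show ?thesis using inv by (auto simp: Anc_def)
  qed
qed

theorem mainTheorem2:
  fixes X :: "'a::semigroup_mult set"
  assumes "X \<noteq> {}"
    and "regular_sg (UNIV :: 'a set)"
    and "weakly_generated X"
  shows "\<exists>\<phi> :: 'a sym list set \<Rightarrow> 'a.
           (\<forall>u\<in>FXwords X. \<forall>v\<in>FXwords X. \<phi> (cls X (u @ v)) = \<phi> (cls X u) * \<phi> (cls X v))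
         \<and> \<phi> ` FX X = UNIV
         \<and> (\<forall>x\<in>X. \<phi> (cls X [Pos x]) = x)"
proof -
  interpret regular_monoid "Elem :: 'a \<Rightarrow> 'a with_one"
    by unfold_locales (rule with_one_regular[OF assms(2)])
  define T where "T = {s. Elem s \<in> mountains X}"
  have "\<exists>b\<in>T. a * b * a = a" if a: "a \<in> T" for a
  proof -
    obtain b where b: "b \<in> mountains X" "Elem a * b * Elem a = Elem a"
      using mountains_regular a unfolding T_def by blast
    show ?thesis
    proof (cases b)
      \<comment> \<open>The inverse found may be the adjoined identity; then \<open>a\<close> is
        idempotent and serves as its own inverse.\<close>
      case Unit
      with b(2) have "a * a * a = a" by simp
      with a show ?thesis by blast
    next
      case (Elem c)
      with b show ?thesis unfolding T_def by auto
    qed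
  qed
  moreover have "a * b \<in> T" if "a \<in> T" "b \<in> T" for a b
    using mountains_mult[of "Elem a" X "Elem b"] that unfolding T_def by simp
  ultimately have "regular_sg T" unfolding regular_sg_def by blast
  moreover have "X \<subseteq> T" unfolding T_def using emb_in_mountains by blast
  ultimately have T: "T = UNIV" using assms(3) unfolding weakly_generated_def by blast

  \<comment> \<open>An arbitrary representative is evaluated: \<open>wval_rho\<close> makes the
    choice irrelevant, and \<open>un_elem\<close> loses nothing because words in
    \<open>FXwords X\<close> never have value \<open>Unit\<close>.\<close>
  define \<phi> where "\<phi> C = un_elem (wval (SOME w. w \<in> C))" for C
  have \<phi>: "\<phi> (cls X w) = un_elem (wval w)" if w: "w \<in> FXwords X" for w
  proof -
    have "w \<in> cls X w"
      using w by (auto simp: cls_def FXwords_def Words_def intro!: rho.refl)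
    then have "(SOME v. v \<in> cls X w) \<in> cls X w" by (rule someI)
    then show ?thesis unfolding \<phi>_def cls_def using wval_rho by fastforce
  qed
  have ne: "\<exists>a. wval w = Elem a" if "w \<in> FXwords X" for w
  proof -
    from that obtain g v where w: "w = g # v" "g \<in> Gen X - {One}"
      unfolding FXwords_def by (cases w) auto
    then have "wval w \<noteq> Unit"
      using val_ne_Unit[OF assms(2) w(2)] by (simp add: with_one_mult_eq_Unit_iff)
    then show ?thesis by (cases "wval w") auto
  qed
  have "\<phi> (cls X (u @ v)) = \<phi> (cls X u) * \<phi> (cls X v)"
    if u: "u \<in> FXwords X" and v: "v \<in> FXwords X" for u v
  proof -
    have "u @ v \<in> FXwords X" using u v unfolding FXwords_def by auto
    then show ?thesis using \<phi> u v ne[OF u] ne[OF v] by auto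
  qed
  moreover have "\<phi> ` FX X = UNIV"
  proof -
    have "a \<in> \<phi> ` FX X" for a
    proof -
      have "Elem a \<in> word_values X" using T mountains_word_values unfolding T_def by blast
      then obtain w where "w \<in> FXwords X" "Elem a = wval w"
        using word_values_FXwords[of "Elem a" X] by (auto simp: one_with_one_def)
      then have "\<phi> (cls X w) = a" "cls X w \<in> FX X"
        using \<phi> by (auto simp: FX_def simp flip: \<open>Elem a = wval w\<close>)
      then show ?thesis by blast
    qed
    then show ?thesis by blast
  qed
  moreover have "\<phi> (cls X [Pos x]) = x" if "x \<in> X" for x
  proof -
    have "[Pos x] \<in> FXwords X" using that by (auto simp: FXwords_def Gen_def Anc_def)
    then show ?thesis using \<phi> by simp
  qed
  ultimately show ?thesis by blast
qed

end
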